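(* Let $\varepsilon=\varepsilon(n)\in(0,1/2)$ satisfy $1/\varepsilon = n^{o(1)}$ (i.e. $\log(1/\varepsilon)=o(\log n)$ as $n\to\infty$). For every constant $C>0$ there exist constants $c>0$ and $n_0$ such that for every $n\ge n_0$ that is a power of $2$ the following holds: if an algorithm ${\mathcal A}=(M^{(0)},\dots,M^{(m)})$ in the linear algebraic model described in the context computes $\operatorname{Id}_n+\varepsilon F_n$ and is $(1+C\varepsilon)$-well conditioned, then $$ m \;\ge\; c\,\frac{n\log n}{\log(1/\varepsilon)}. $$
   Context: For $n=2^k$, $F_n$ is the (normalized) $n\times n$ Walsh–Hadamard matrix, $F_n(i,j)=n^{-1/2}(-1)^{\langle i-1,j-1\rangle}$, where $\langle a,b\rangle$ is the dot product (over the integers) of the base-$2$ digit vectors of the integers $a,b$; it is symmetric and orthogonal. $\operatorname{Id}_n+\varepsilon F_n$ is called a Fourier $\varepsilon$-perturbation. For $i\ne i'$ and an angle $\Theta$, $R_{i,i',\Theta}\in\mathbb R^{n\times n}$ is the matrix with $R(i,i)=R(i',i')=\cos\Theta$, $R(i,i')=\sin\Theta$, $R(i',i)=-\sin\Theta$, all other diagonal entries $1$ and all other entries $0$. An algorithm with $m$ steps is a sequence of real $n\times n$ matrices ${\mathcal A}=(M^{(0)}=\operatorname{Id}_n,M^{(1)},\dots,M^{(m)})$ where for each $t\in[m]$ either (constant gate) $M^{(t)}$ is obtained from $M^{(t-1)}$ by multiplying one row by a nonzero real constant, or (rotation) $M^{(t)}=R_{i_t,i'_t,\Theta_t}M^{(t-1)}$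 for some rows $i_t\neq i'_t$ and angle $\Theta_t$. ${\mathcal A}$ computes $X$ if $M^{(m)}=X$. The condition number $\kappa(M)$ of a nonsingular matrix is the ratio of its largest to smallest singular value; ${\mathcal A}$ is $\kappa$-well conditioned if $\kappa(M^{(t)})\le\kappa$ for all $t\in[m]$. Logarithms are base $2$. *)

theory Defs
  imports Complex_Main "HOL-Library.Landau_Symbols"
begin

text \<open>n x n real matrices are represented as functions nat => nat => real,
  with row/column indices 0..n-1 (index i here corresponds to index i+1 in the paper);
  entries outside this range are irrelevant.  Vectors are nat => real on 0..n-1.\<close>

type_synonym rmat = "nat \<Rightarrow> nat \<Rightarrow> real"

definition idm :: rmat where
  "idm i j = (if i = j then 1 else 0)"

definition walsh :: "nat \<Rightarrow> rmat" where
  "walsh n i j = (-1) ^ card {k. k < n \<and> bit i k \<and> bit j k} / sqrt (real n)"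

definition rot :: "nat \<Rightarrow> nat \<Rightarrow> real \<Rightarrow> rmat" where
  "rot i i' \<Theta> a b =
     (if a = i \<and> b = i then cos \<Theta>
      else if a = i' \<and> b = i' then cos \<Theta>
      else if a = i \<and> b = i' then sin \<Theta>
      else if a = i' \<and> b = i then - sin \<Theta>
      else if a = b then 1 else 0)"

definition mmult :: "nat \<Rightarrow> rmat \<Rightarrow> rmat \<Rightarrow> rmat" where
  "mmult n A B a b = (\<Sum>k<n. A a k * B k b)"

definition meq :: "nat \<Rightarrow> rmat \<Rightarrow> rmat \<Rightarrow> bool" where
  "meq n A B \<longleftrightarrow> (\<forall>a<n. \<forall>b<n. A a b = B a b)"

definition alg_step :: "nat \<Rightarrow> rmat \<Rightarrow> rmat \<Rightarrow> bool" where
  "alg_step n A B \<longleftrightarrow>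
     (\<exists>i<n. \<exists>c::real. c \<noteq> 0 \<and>
        meq n B (\<lambda>a b. if a = i then c * A a b else A a b))
   \<or> (\<exists>i<n. \<exists>i'<n. \<exists>\<Theta>::real. i \<noteq> i' \<and> meq n B (mmult n (rot i i' \<Theta>) A))"

text \<open>An algorithm with m steps is a list [M0, ..., Mm] of length m+1.\<close>
definition is_algorithm :: "nat \<Rightarrow> rmat list \<Rightarrow> bool" where
  "is_algorithm n Ms \<longleftrightarrow> Ms \<noteq> [] \<and> meq n (Ms ! 0) idm \<and>
     (\<forall>t. 1 \<le> t \<and> t < length Ms \<longrightarrow> alg_step n (Ms ! (t - 1)) (Ms ! t))"

definition computes :: "nat \<Rightarrow> rmat list \<Rightarrow> rmat \<Rightarrow> bool" where
  "computes n Ms X \<longleftrightarrow> meq n (last Ms) X"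

definition vnorm :: "nat \<Rightarrow> (nat \<Rightarrow> real) \<Rightarrow> real" where
  "vnorm n x = sqrt (\<Sum>k<n. (x k)\<^sup>2)"

definition mvec :: "nat \<Rightarrow> rmat \<Rightarrow> (nat \<Rightarrow> real) \<Rightarrow> (nat \<Rightarrow> real)" where
  "mvec n M x a = (\<Sum>b<n. M a b * x b)"

text \<open>Largest / smallest singular value (variational characterization).\<close>
definition smax :: "nat \<Rightarrow> rmat \<Rightarrow> real" where
  "smax n M = Sup ((\<lambda>x. vnorm n (mvec n M x)) ` {x. vnorm n x = 1})"

definition smin :: "nat \<Rightarrow> rmat \<Rightarrow> real" where
  "smin n M = Inf ((\<lambda>x. vnorm n (mvec n M x)) ` {x. vnorm n x = 1})"

text \<open>Condition number kappa(M) = smax/smin of a nonsingular matrix; "kappa(M) <= k" is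
  expressed as nonsingularity (smin > 0) together with smax <= k * smin.\<close>
definition cond_le :: "nat \<Rightarrow> rmat \<Rightarrow> real \<Rightarrow> bool" where
  "cond_le n M k \<longleftrightarrow> smin n M > 0 \<and> smax n M \<le> k * smin n M"

definition well_conditioned :: "nat \<Rightarrow> real \<Rightarrow> rmat list \<Rightarrow> bool" where
  "well_conditioned n k Ms \<longleftrightarrow> (\<forall>t. 1 \<le> t \<and> t < length Ms \<longrightarrow> cond_le n (Ms ! t) k)"

end

theory Submission
  imports Defs
begin

text \<open>
  Write \<open>N = M\<^sup>-\<^sup>T\<close> and \<open>f t = - t ln \<bar>t\<bar>\<close>. The potential is the difference of two
  quasi-entropies preconditioned by \<open>F\<close>,
  \<open>\<Psi>(M) = \<Sum>\<^sub>i\<^sub>j (f (M\<^sub>i\<^sub>j (N F)\<^sub>i\<^sub>j) - f ((M F)\<^sub>i\<^sub>j N\<^sub>i\<^sub>j))\<close>.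
  Constant gates do not change it, since they scale a row of \<open>M\<close> by \<open>c\<close> and the same row of
  \<open>N\<close> by \<open>1/c\<close>. It vanishes on orthogonal matrices, and on a \<open>(1 + C\<epsilon>)\<close>-well conditioned one
  the rows of \<open>M/s\<close> and \<open>s N\<close> (with \<open>s\<close> the least singular value) differ by \<open>O(\<epsilon>)\<close> in norm, so
  that the modulus of continuity of \<open>t ln t\<close> limits the effect of a rotation to
  \<open>O(\<epsilon> ln (1/\<epsilon>))\<close>. On the other hand \<open>\<Psi>(Id) = 0\<close>, while at \<open>Id + \<epsilon>F\<close> the off-diagonal
  arguments of \<open>f\<close> are about \<open>\<epsilon>/n\<close> in the first sum and \<open>-\<epsilon>/n\<close> in the second, so that
  \<open>\<Psi>(Id + \<epsilon>F)\<close> is of order \<open>\<epsilon> n ln n\<close>.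
\<close>

subsection \<open>Continuity of the entropy function\<close>

definition ent :: "real \<Rightarrow> real" where
  "ent t = - t * ln \<bar>t\<bar>"

lemma ent_0 [simp]: "ent 0 = 0"
  by (simp add: ent_def)

lemma ent_minus [simp]: "ent (- t) = - ent t"
  by (simp add: ent_def)

text \<open>Cutting the logarithm off below \<open>m\<close> alters the value by at most
  \<open>\<bar>t\<bar> * ln (m / \<bar>t\<bar>)\<close>, which \<open>ln y \<le> y\<close> bounds by
  \<open>m\<close>. The cut-off removes the infinite slope of \<open>ent\<close> at 0.\<close>

lemma ent_truncate:
  assumes "0 < m"
  shows "\<bar>ent t + t * ln (max \<bar>t\<bar> m)\<bar> \<le> m"
proof (cases "\<bar>t\<bar> < m \<and> t \<noteq> 0")
  case True
  then have "ln (m / \<bar>t\<bar>) \<le> m / \<bar>t\<bar> - 1" "0 \<le> ln (m / \<bar>t\<bar>)"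
    using assms by (auto intro!: ln_le_minus_one)
  moreover have "ent t + t * ln (max \<bar>t\<bar> m) = t * ln (m / \<bar>t\<bar>)"
    using True assms by (simp add: ent_def ln_div algebra_simps)
  moreover have "\<bar>t\<bar> * ln (m / \<bar>t\<bar>) \<le> \<bar>t\<bar> * (m / \<bar>t\<bar>)"
    using calculation by (intro mult_left_mono) auto
  ultimately show ?thesis using True by (simp add: abs_mult)
next
  case False
  then show ?thesis using assms by (auto simp: ent_def max_def)
qed

text \<open>With \<open>p \<ge> q\<close> the two truncated moduli, the difference is
  \<open>(u - v) * ln (p / B) + v * ln (p / q)\<close>. The first logarithm lies between
  \<open>- ln (B / m)\<close> and 0; the second term is at most \<open>p - q\<close> because
  \<open>ln y \<le> y - 1\<close> and \<open>\<bar>v\<bar> \<le> q\<close>.\<close>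

lemma truncated_lipschitz:
  fixes m B u v :: real
  assumes "0 < m" "m \<le> B" "\<bar>u\<bar> \<le> B" "\<bar>v\<bar> \<le> B"
  shows "\<bar>u * ln (max \<bar>u\<bar> m / B) - v * ln (max \<bar>v\<bar> m / B)\<bar> \<le> \<bar>u - v\<bar> * (1 + ln (B / m))"
proof -
  \<comment> \<open>The claim is symmetric in \<open>u\<close> and \<open>v\<close>, so the larger
    truncated modulus may be assumed to belong to \<open>u\<close>.\<close>
  have *: "\<bar>u * ln (max \<bar>u\<bar> m / B) - v * ln (max \<bar>v\<bar> m / B)\<bar> \<le> \<bar>u - v\<bar> * (1 + ln (B / m))"
    if uv: "max \<bar>v\<bar> m \<le> max \<bar>u\<bar> m" "\<bar>u\<bar> \<le> B" "\<bar>v\<bar> \<le> B" for u v :: real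
  proof -
    define p q where "p = max \<bar>u\<bar> m" and "q = max \<bar>v\<bar> m"
    have pq: "0 < q" "q \<le> p" "p \<le> B" "m \<le> p" "\<bar>v\<bar> \<le> q"
      using assms uv by (auto simp: p_def q_def)
    have "ln (p / q) \<le> p / q - 1" using pq by (intro ln_le_minus_one) auto
    then have "q * ln (p / q) \<le> q * (p / q - 1)" using pq by (intro mult_left_mono) auto
    also have "\<dots> = p - q" using pq by (simp add: algebra_simps)
    also have "\<dots> \<le> \<bar>u - v\<bar>" unfolding p_def q_def by (auto simp: max_def)
    finally have 1: "q * ln (p / q) \<le> \<bar>u - v\<bar>" .
    have "\<bar>v\<bar> * ln (p / q) \<le> q * ln (p / q)" using pq by (intro mult_right_mono) auto
    with 1 have 2: "\<bar>v * ln (p / q)\<bar> \<le> \<bar>u - v\<bar>" using pq by (simp add: abs_mult)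
    have "ln (m / B) \<le> ln (p / B)" "ln (p / B) \<le> 0" "ln (m / B) = - ln (B / m)"
      using pq assms by (auto simp: divide_right_mono ln_div)
    then have "\<bar>u - v\<bar> * \<bar>ln (p / B)\<bar> \<le> \<bar>u - v\<bar> * ln (B / m)"
      by (intro mult_left_mono) auto
    then have 3: "\<bar>(u - v) * ln (p / B)\<bar> \<le> \<bar>u - v\<bar> * ln (B / m)"
      by (simp add: abs_mult)
    have "u * ln (p / B) - v * ln (q / B) = (u - v) * ln (p / B) + v * ln (p / q)"
      using pq assms by (simp add: ln_div algebra_simps)
    with 2 3 have "\<bar>u * ln (p / B) - v * ln (q / B)\<bar> \<le> \<bar>u - v\<bar> + \<bar>u - v\<bar> * ln (B / m)"
      by linarith
    then show ?thesis unfolding p_def q_def by (simp only: distrib_left mult_1_right)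
  qed
  show ?thesis
  proof (cases "max \<bar>v\<bar> m \<le> max \<bar>u\<bar> m")
    case True
    then show ?thesis using * assms by blast
  next
    case False
    then have "max \<bar>u\<bar> m \<le> max \<bar>v\<bar> m" by linarith
    from *[OF this assms(4,3)] show ?thesis by (simp only: abs_minus_commute)
  qed
qed

text \<open>The scale-dependent term \<open>(u - v) * ln B\<close> is kept separate because it cancels
  over the four products affected by a rotation; this is what removes every \<open>ln n\<close>
  from the cost of a step.\<close>
lemma ent_modulus:
  assumes "0 < \<tau>" "\<tau> \<le> 1" "\<bar>u\<bar> \<le> B" "\<bar>v\<bar> \<le> B"
  shows "\<bar>ent u - ent v + (u - v) * ln B\<bar> \<le> \<bar>u - v\<bar> * (1 + ln (1 / \<tau>)) + 2 * \<tau> * B"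
proof (cases "B = 0")
  case True
  then show ?thesis using assms by simp
next
  case False
  then have B: "B > 0" using assms by linarith
  \<comment> \<open>A cut-off relative to \<open>B\<close> makes the Lipschitz constant depend on
    \<open>\<tau>\<close> alone; the two truncation errors add up to
    \<open>2 * \<tau> * B\<close>.\<close>
  define m where "m = \<tau> * B"
  have m: "0 < m" "m \<le> B" "B / m = 1 / \<tau>" using assms B by (auto simp: m_def)
  have p: "max \<bar>t\<bar> m > 0" for t using m by (auto simp: max_def)
  have L: "t * ln (max \<bar>t\<bar> m / B) = t * ln (max \<bar>t\<bar> m) - t * ln B" for t
    using p[of t] B by (simp add: ln_div algebra_simps)
  have "\<bar>(u * ln (max \<bar>u\<bar> m) - u * ln B) - (v * ln (max \<bar>v\<bar> m) - v * ln B)\<bar>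
      \<le> \<bar>u - v\<bar> * (1 + ln (1 / \<tau>))"
    using truncated_lipschitz[OF m(1,2) assms(3,4)] m L by simp
  moreover have "2 * \<tau> * B = m + m" by (simp add: m_def)
  ultimately show ?thesis
    using ent_truncate[OF m(1), of u] ent_truncate[OF m(1), of v]
    by (simp add: algebra_simps abs_le_iff)
qed

text \<open>For a fixed column, \<open>x\<close>, \<open>y\<close>, \<open>z\<close>,
  \<open>w\<close> stand for the entries of \<open>M\<close>, \<open>N F\<close>,
  \<open>M F\<close>, \<open>N\<close> in the two rotated rows, and \<open>e\<close>,
  \<open>d\<close> for the deviations between \<open>M\<close> and \<open>N\<close> before and after
  applying \<open>F\<close>. Every product is at most \<open>S\<close>, the two products of a pair
  differ by at most \<open>\<epsilon> * S\<close>, and the terms with \<open>ln S\<close> cancel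
  over the four pairs. The weight \<open>1 / \<epsilon>\<^sup>2\<close> fits deviations of relative
  size \<open>\<epsilon>\<close>.\<close>

lemma rotation_column:
  fixes x1 x2 y1 y2 e1 e2 d1 d2 c s \<epsilon> :: real
  assumes cs: "c\<^sup>2 + s\<^sup>2 = 1" and eps: "0 < \<epsilon>" "\<epsilon> < 1"
  defines "S \<equiv> 2 * (x1\<^sup>2 + x2\<^sup>2 + y1\<^sup>2 + y2\<^sup>2 + (e1\<^sup>2 + e2\<^sup>2 + d1\<^sup>2 + d2\<^sup>2) / \<epsilon>\<^sup>2)"
    and "w1 \<equiv> x1 - e1" and "w2 \<equiv> x2 - e2" and "z1 \<equiv> y1 + d1" and "z2 \<equiv> y2 + d2"
  shows "\<bar>(ent ((c * x1 + s * x2) * (c * y1 + s * y2)) - ent ((c * z1 + s * z2) * (c * w1 + s * w2)))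
        + (ent ((- s * x1 + c * x2) * (- s * y1 + c * y2)) - ent ((- s * z1 + c * z2) * (- s * w1 + c * w2)))
        - (ent (x1 * y1) - ent (z1 * w1)) - (ent (x2 * y2) - ent (z2 * w2))\<bar>
     \<le> 4 * (\<epsilon> * S * (3 + ln (1 / \<epsilon>)))"
proof -
  define X Y E D where "X = \<bar>x1\<bar> + \<bar>x2\<bar>" and "Y = \<bar>y1\<bar> + \<bar>y2\<bar>"
    and "E = \<bar>e1\<bar> + \<bar>e2\<bar>" and "D = \<bar>d1\<bar> + \<bar>d2\<bar>"
  have nn: "0 \<le> X" "0 \<le> Y" "0 \<le> E" "0 \<le> D" by (auto simp: X_def Y_def E_def D_def)
  have sq: "(\<bar>a\<bar> + \<bar>b\<bar>)\<^sup>2 \<le> 2 * (a\<^sup>2 + b\<^sup>2)" for a b :: real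
    using sum_squares_bound[of "\<bar>a\<bar>" "\<bar>b\<bar>"] by (simp add: power2_sum)
  define T where "T = X\<^sup>2 + Y\<^sup>2 + (E\<^sup>2 + D\<^sup>2) / \<epsilon>\<^sup>2"
  have TS: "T \<le> S"
  proof -
    have "(E\<^sup>2 + D\<^sup>2) / \<epsilon>\<^sup>2 \<le> 2 * (e1\<^sup>2 + e2\<^sup>2 + d1\<^sup>2 + d2\<^sup>2) / \<epsilon>\<^sup>2"
      using sq[of e1 e2] sq[of d1 d2] eps by (intro divide_right_mono) (auto simp: E_def D_def)
    then show ?thesis
      using sq[of x1 x2] sq[of y1 y2] by (simp add: T_def S_def X_def Y_def)
  qed
  have e2: "\<epsilon>\<^sup>2 \<le> 1" "0 < \<epsilon>\<^sup>2" using eps by (auto simp: power_le_one)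
  have EDeps: "E\<^sup>2 + D\<^sup>2 \<le> (E\<^sup>2 + D\<^sup>2) / \<epsilon>\<^sup>2"
    using e2 mult_right_mono[OF e2(1), of "E\<^sup>2 + D\<^sup>2"] by (simp add: field_simps)
  have prod_le: "a * b \<le> (a\<^sup>2 + b\<^sup>2) / 2" for a b :: real
    using sum_squares_bound[of a b] by simp
  have "(X + E) * (Y + D) \<le> ((X + E)\<^sup>2 + (Y + D)\<^sup>2) / 2" by (rule prod_le)
  also have "\<dots> \<le> X\<^sup>2 + E\<^sup>2 + Y\<^sup>2 + D\<^sup>2"
    using sq[of X E] sq[of Y D] nn by simp
  also have "\<dots> \<le> S" using EDeps TS unfolding T_def by linarith
  finally have XE: "(X + E) * (Y + D) \<le> S" .
  \<comment> \<open>The arithmetic-geometric mean inequality for \<open>a\<close> and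
    \<open>b / \<epsilon>\<close>: a size times a deviation gains a factor
    \<open>\<epsilon>\<close>.\<close>
  have wprod: "a * b \<le> (\<epsilon> * a\<^sup>2 + \<epsilon> * (b\<^sup>2 / \<epsilon>\<^sup>2)) / 2" for a b :: real
  proof -
    have "a * b = \<epsilon> * (a * (b / \<epsilon>))" using eps by simp
    also have "\<dots> \<le> \<epsilon> * ((a\<^sup>2 + (b / \<epsilon>)\<^sup>2) / 2)" using eps by (intro mult_left_mono prod_le) auto
    finally show ?thesis by (simp add: power_divide algebra_simps)
  qed
  have "E * D \<le> (E\<^sup>2 + D\<^sup>2) / 2" by (rule prod_le)
  also have "\<dots> \<le> \<epsilon> * ((E\<^sup>2 + D\<^sup>2) / \<epsilon>\<^sup>2) / 2"
  proof -
    have "\<epsilon> * (E\<^sup>2 + D\<^sup>2) \<le> E\<^sup>2 + D\<^sup>2" using eps by (intro mult_left_le_one_le) auto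
    then have "E\<^sup>2 + D\<^sup>2 \<le> (E\<^sup>2 + D\<^sup>2) / \<epsilon>" using eps by (simp add: pos_le_divide_eq mult.commute)
    also have "\<dots> = \<epsilon> * ((E\<^sup>2 + D\<^sup>2) / \<epsilon>\<^sup>2)" using eps by (simp add: power2_eq_square)
    finally show ?thesis by simp
  qed
  finally have "Y * E + X * D + E * D \<le> \<epsilon> * T"
    using wprod[of Y E] wprod[of X D]
      mult_nonneg_nonneg[OF less_imp_le[OF eps(1)] zero_le_power2[of X]]
      mult_nonneg_nonneg[OF less_imp_le[OF eps(1)] zero_le_power2[of Y]]
    unfolding T_def distrib_left add_divide_distrib by linarith
  also have "\<dots> \<le> \<epsilon> * S" using TS eps by simp
  finally have Del: "Y * E + X * D + E * D \<le> \<epsilon> * S" .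
  have L0: "0 \<le> ln (1 / \<epsilon>)" using eps by simp
  \<comment> \<open>This is \<open>ent_modulus\<close> with \<open>B = S\<close> and
    \<open>\<tau> = \<epsilon>\<close>; the 3 is 1 from the Lipschitz part plus 2 from
    truncation.\<close>
  have key: "\<bar>ent (x * y) - ent ((y + d) * (x - e)) + (x * y - (y + d) * (x - e)) * ln S\<bar>
      \<le> \<epsilon> * S * (3 + ln (1 / \<epsilon>))"
    if b: "\<bar>x\<bar> \<le> X" "\<bar>y\<bar> \<le> Y" "\<bar>e\<bar> \<le> E" "\<bar>d\<bar> \<le> D" for x y e d
  proof -
    have "\<bar>x * y\<bar> \<le> (X + E) * (Y + D)" unfolding abs_mult
      using b nn by (intro mult_mono) auto
    then have 1: "\<bar>x * y\<bar> \<le> S" using XE by linarith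
    have "\<bar>(y + d) * (x - e)\<bar> \<le> (Y + D) * (X + E)" unfolding abs_mult
      using b nn by (intro mult_mono) auto
    then have 2: "\<bar>(y + d) * (x - e)\<bar> \<le> S" using XE by (simp add: mult.commute)
    have "\<bar>x * y - (y + d) * (x - e)\<bar> = \<bar>y * e - x * d + e * d\<bar>" by (simp add: algebra_simps)
    also have "\<dots> \<le> \<bar>y\<bar> * \<bar>e\<bar> + \<bar>x\<bar> * \<bar>d\<bar> + \<bar>e\<bar> * \<bar>d\<bar>"
      unfolding abs_mult[symmetric] by linarith
    also have "\<dots> \<le> Y * E + X * D + E * D" using b nn by (intro add_mono mult_mono) auto
    finally have 3: "\<bar>x * y - (y + d) * (x - e)\<bar> \<le> \<epsilon> * S" using Del by linarith
    have "\<bar>ent (x * y) - ent ((y + d) * (x - e)) + (x * y - (y + d) * (x - e)) * ln S\<bar>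
       \<le> \<bar>x * y - (y + d) * (x - e)\<bar> * (1 + ln (1 / \<epsilon>)) + 2 * \<epsilon> * S"
      using eps 1 2 by (intro ent_modulus) auto
    also have "\<dots> \<le> \<epsilon> * S * (1 + ln (1 / \<epsilon>)) + 2 * \<epsilon> * S"
      using 3 L0 by (intro add_right_mono mult_right_mono) auto
    finally show ?thesis by (simp add: algebra_simps)
  qed
  have "c\<^sup>2 \<le> 1" "s\<^sup>2 \<le> 1" using cs zero_le_power2[of c] zero_le_power2[of s] by linarith+
  then have cs1: "\<bar>c\<bar> \<le> 1" "\<bar>s\<bar> \<le> 1" by (simp_all add: abs_square_le_1)
  \<comment> \<open>\<open>X\<close>, \<open>Y\<close>, \<open>E\<close>, \<open>D\<close> are sums
    of two absolute values, so they bound the rotated quantities as well and \<open>key\<close>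
    applies before and after the gate.\<close>
  have rb: "\<bar>c * a + s * b\<bar> \<le> \<bar>a\<bar> + \<bar>b\<bar>" "\<bar>- s * a + c * b\<bar> \<le> \<bar>a\<bar> + \<bar>b\<bar>" for a b
  proof -
    have "\<bar>c * a\<bar> \<le> \<bar>a\<bar>" "\<bar>s * b\<bar> \<le> \<bar>b\<bar>" "\<bar>s * a\<bar> \<le> \<bar>a\<bar>" "\<bar>c * b\<bar> \<le> \<bar>b\<bar>"
      unfolding abs_mult using cs1 by (auto intro!: mult_left_le_one_le)
    then show "\<bar>c * a + s * b\<bar> \<le> \<bar>a\<bar> + \<bar>b\<bar>" "\<bar>- s * a + c * b\<bar> \<le> \<bar>a\<bar> + \<bar>b\<bar>" by linarith+
  qed
  have k1: "\<bar>ent (x1 * y1) - ent (z1 * w1) + (x1 * y1 - z1 * w1) * ln S\<bar> \<le> \<epsilon> * S * (3 + ln (1 / \<epsilon>))"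
    unfolding z1_def w1_def by (rule key) (auto simp: X_def Y_def E_def D_def)
  have k2: "\<bar>ent (x2 * y2) - ent (z2 * w2) + (x2 * y2 - z2 * w2) * ln S\<bar> \<le> \<epsilon> * S * (3 + ln (1 / \<epsilon>))"
    unfolding z2_def w2_def by (rule key) (auto simp: X_def Y_def E_def D_def)
  define u3 v3 u4 v4 where "u3 = (c * x1 + s * x2) * (c * y1 + s * y2)"
    and "v3 = (c * z1 + s * z2) * (c * w1 + s * w2)"
    and "u4 = (- s * x1 + c * x2) * (- s * y1 + c * y2)"
    and "v4 = (- s * z1 + c * z2) * (- s * w1 + c * w2)"
  have k3: "\<bar>ent u3 - ent v3 + (u3 - v3) * ln S\<bar> \<le> \<epsilon> * S * (3 + ln (1 / \<epsilon>))"
  proof -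
    have "c * z1 + s * z2 = (c * y1 + s * y2) + (c * d1 + s * d2)"
      "c * w1 + s * w2 = (c * x1 + s * x2) - (c * e1 + s * e2)"
      by (simp_all add: z1_def z2_def w1_def w2_def algebra_simps)
    then show ?thesis
      unfolding u3_def v3_def by (simp only:) (rule key; simp only: X_def Y_def E_def D_def rb)
  qed
  have k4: "\<bar>ent u4 - ent v4 + (u4 - v4) * ln S\<bar> \<le> \<epsilon> * S * (3 + ln (1 / \<epsilon>))"
  proof -
    have "- s * z1 + c * z2 = (- s * y1 + c * y2) + (- s * d1 + c * d2)"
      "- s * w1 + c * w2 = (- s * x1 + c * x2) - (- s * e1 + c * e2)"
      by (simp_all add: z1_def z2_def w1_def w2_def algebra_simps)
    then show ?thesis
      unfolding u4_def v4_def by (simp only:) (rule key; simp only: X_def Y_def E_def D_def rb)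
  qed
  \<comment> \<open>Rotations preserve the dot product of two pairs, hence the coefficients of
    \<open>ln S\<close> sum to 0.\<close>
  have inv: "(c * a + s * b) * (c * a' + s * b') + (- s * a + c * b) * (- s * a' + c * b') = a * a' + b * b'"
    for a b a' b'
  proof -
    have "(c * a + s * b) * (c * a' + s * b') + (- s * a + c * b) * (- s * a' + c * b')
        = (c\<^sup>2 + s\<^sup>2) * (a * a' + b * b')" by (simp add: algebra_simps power2_eq_square)
    then show ?thesis by (simp add: cs)
  qed
  have "u3 + u4 = x1 * y1 + x2 * y2" "v3 + v4 = z1 * w1 + z2 * w2"
    unfolding u3_def u4_def v3_def v4_def by (rule inv)+
  then have "(u3 - v3) + (u4 - v4) - (x1 * y1 - z1 * w1) - (x2 * y2 - z2 * w2) = 0" by linarith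
  then have "((u3 - v3) + (u4 - v4) - (x1 * y1 - z1 * w1) - (x2 * y2 - z2 * w2)) * ln S = 0" by simp
  then have "(u3 - v3) * ln S + (u4 - v4) * ln S - (x1 * y1 - z1 * w1) * ln S
      - (x2 * y2 - z2 * w2) * ln S = 0"
    by (simp only: left_diff_distrib distrib_right)
  then show ?thesis
    using k1 k2 k3 k4 unfolding u3_def[symmetric] v3_def[symmetric] u4_def[symmetric] v4_def[symmetric]
    by linarith
qed

text \<open>Serves to absorb additive constants: it gives
  \<open>3 + ln (1 / \<epsilon>) \<le> 7 * ln (1 / \<epsilon>)\<close>.\<close>

lemma ln_inverse_ge_half: "0 < \<epsilon> \<Longrightarrow> \<epsilon> < 1/2 \<Longrightarrow> 1 / 2 \<le> ln (1 / \<epsilon>)" for \<epsilon> :: real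
proof -
  assume e: "0 < \<epsilon>" "\<epsilon> < 1/2"
  have "ln 2 \<le> ln (1 / \<epsilon>)" using e by (intro ln_mono) (auto simp: field_simps)
  then show ?thesis using exp_half_le2 ln_ge_iff[of 2 "1/2"] by linarith
qed

subsection \<open>Quasi-entropy difference of a matrix and its inverse transpose\<close>

text \<open>This is \<open>M N\<^sup>T = Id\<close>, so \<open>N\<close> is the inverse transpose of
  \<open>M\<close>. As a relation it needs no inversion operator, and \<open>biorth n F F\<close>
  expresses that \<open>F\<close> is orthogonal.\<close>

definition biorth :: "nat \<Rightarrow> rmat \<Rightarrow> rmat \<Rightarrow> bool" where
  "biorth n M N \<longleftrightarrow> (\<forall>a<n. \<forall>b<n. (\<Sum>k<n. M a k * N b k) = idm a b)"

definition vmul :: "nat \<Rightarrow> rmat \<Rightarrow> (nat \<Rightarrow> real) \<Rightarrow> nat \<Rightarrow> real" where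
  "vmul n F x j = (\<Sum>k<n. x k * F k j)"

lemma sum_idm [simp]:
  assumes "a < n"
  shows "(\<Sum>k<n. idm a k * g k) = g a" "(\<Sum>k<n. g k * idm k a) = g a"
    "(\<Sum>k<n. idm k a * g k) = g a" "(\<Sum>k<n. g k * idm a k) = g a"
  using assms by (simp_all add: idm_def if_distrib if_distribR cong: if_cong)

lemma vmul_lin: "vmul n F (\<lambda>k. p * x k + q * y k) j = p * vmul n F x j + q * vmul n F y j"
  by (simp add: vmul_def sum.distrib sum_distrib_left algebra_simps)

lemma vmul_scale: "vmul n F (\<lambda>k. p * x k) j = p * vmul n F x j"
  by (simp add: vmul_def sum_distrib_left algebra_simps)

lemma vmul_diff: "vmul n F (\<lambda>k. x k - y k) j = vmul n F x j - vmul n F y j"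
  by (simp add: vmul_def sum_subtractf algebra_simps)

lemma vmul_cong: "(\<And>k. k < n \<Longrightarrow> x k = y k) \<Longrightarrow> vmul n F x j = vmul n F y j"
  by (simp add: vmul_def)

lemma vmul_parseval:
  assumes "biorth n F F"
  shows "(\<Sum>j<n. (vmul n F x j)\<^sup>2) = (\<Sum>k<n. (x k)\<^sup>2)"
proof -
  have "(\<Sum>j<n. (vmul n F x j)\<^sup>2) = (\<Sum>j<n. \<Sum>k<n. \<Sum>l<n. x k * x l * (F k j * F l j))"
    by (simp add: vmul_def power2_eq_square sum_product algebra_simps)
  also have "\<dots> = (\<Sum>k<n. \<Sum>l<n. \<Sum>j<n. x k * x l * (F k j * F l j))"
    by (subst sum.swap, rule sum.cong[OF refl], rule sum.swap)
  also have "\<dots> = (\<Sum>k<n. \<Sum>l<n. x k * x l * idm k l)"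
    using assms by (simp add: sum_distrib_left[symmetric] biorth_def)
  also have "\<dots> = (\<Sum>k<n. x k * (\<Sum>l<n. x l * idm k l))"
    by (simp only: sum_distrib_left mult.assoc)
  also have "\<dots> = (\<Sum>k<n. x k * x k)" by (intro sum.cong refl) simp
  finally show ?thesis by (simp add: power2_eq_square)
qed

text \<open>The potential splits over rows, so a gate affects only the one or two summands of the
  rows it touches.\<close>

definition row_pot :: "nat \<Rightarrow> rmat \<Rightarrow> (nat \<Rightarrow> real) \<Rightarrow> (nat \<Rightarrow> real) \<Rightarrow> real" where
  "row_pot n F x y = (\<Sum>j<n. ent (x j * vmul n F y j) - ent (vmul n F x j * y j))"

definition pot :: "nat \<Rightarrow> rmat \<Rightarrow> rmat \<Rightarrow> rmat \<Rightarrow> real" where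
  "pot n F M N = (\<Sum>i<n. row_pot n F (M i) (N i))"

text \<open>Each argument of \<open>ent\<close> has one factor from \<open>x\<close> and one from
  \<open>y\<close>, so the scalars cancel. This covers constant gates and also allows rows to be
  normalized before a rotation is estimated.\<close>

lemma row_pot_scale:
  assumes "c \<noteq> 0"
  shows "row_pot n F (\<lambda>k. c * x k) (\<lambda>k. (1 / c) * y k) = row_pot n F x y"
  unfolding row_pot_def vmul_scale using assms by simp

lemma row_pot_cong:
  "(\<And>k. k < n \<Longrightarrow> x k = x' k) \<Longrightarrow> (\<And>k. k < n \<Longrightarrow> y k = y' k) \<Longrightarrow> row_pot n F x y = row_pot n F x' y'"
  unfolding row_pot_def by (intro sum.cong refl) (simp add: vmul_cong[of n x x'] vmul_cong[of n y y'])

text \<open>Sums \<open>rotation_column\<close> over the columns. By Parseval the entries after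
  applying \<open>F\<close> obey the same norm bounds, so the quantities \<open>S j\<close> sum to
  at most \<open>16 * R\<close>; the constant is \<open>448 = 4 * 7 * 16\<close>.\<close>

lemma row_pot_rotate:
  fixes x1 x2 y1 y2 :: "nat \<Rightarrow> real"
  assumes F: "biorth n F F" and eps: "0 < \<epsilon>" "\<epsilon> < 1/2" and cs: "c\<^sup>2 + s\<^sup>2 = 1"
    and x: "(\<Sum>j<n. (x1 j)\<^sup>2) \<le> R" "(\<Sum>j<n. (x2 j)\<^sup>2) \<le> R"
    and y: "(\<Sum>j<n. (y1 j)\<^sup>2) \<le> R" "(\<Sum>j<n. (y2 j)\<^sup>2) \<le> R"
    and e: "(\<Sum>j<n. (x1 j - y1 j)\<^sup>2) \<le> \<epsilon>\<^sup>2 * R" "(\<Sum>j<n. (x2 j - y2 j)\<^sup>2) \<le> \<epsilon>\<^sup>2 * R"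
  shows "\<bar>row_pot n F (\<lambda>k. c * x1 k + s * x2 k) (\<lambda>k. c * y1 k + s * y2 k)
        + row_pot n F (\<lambda>k. - s * x1 k + c * x2 k) (\<lambda>k. - s * y1 k + c * y2 k)
        - row_pot n F x1 y1 - row_pot n F x2 y2\<bar> \<le> 448 * R * (\<epsilon> * ln (1 / \<epsilon>))"
proof -
  let ?v = "vmul n F"
  define e1 e2 where "e1 = (\<lambda>j. x1 j - y1 j)" and "e2 = (\<lambda>j. x2 j - y2 j)"
  define S where "S = (\<lambda>j. 2 * ((x1 j)\<^sup>2 + (x2 j)\<^sup>2 + (?v y1 j)\<^sup>2 + (?v y2 j)\<^sup>2 +
      ((e1 j)\<^sup>2 + (e2 j)\<^sup>2 + (?v e1 j)\<^sup>2 + (?v e2 j)\<^sup>2) / \<epsilon>\<^sup>2))"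
  define G where "G = (\<lambda>j.
     (ent ((c * x1 j + s * x2 j) * (c * ?v y1 j + s * ?v y2 j)) - ent ((c * ?v x1 j + s * ?v x2 j) * (c * y1 j + s * y2 j)))
   + (ent ((- s * x1 j + c * x2 j) * (- s * ?v y1 j + c * ?v y2 j)) - ent ((- s * ?v x1 j + c * ?v x2 j) * (- s * y1 j + c * y2 j)))
   - (ent (x1 j * ?v y1 j) - ent (?v x1 j * y1 j)) - (ent (x2 j * ?v y2 j) - ent (?v x2 j * y2 j)))"
  have eq: "?v y1 j + ?v e1 j = ?v x1 j" "?v y2 j + ?v e2 j = ?v x2 j"
    "x1 j - e1 j = y1 j" "x2 j - e2 j = y2 j" for j
    by (simp_all add: e1_def e2_def vmul_diff)
  have col: "\<bar>G j\<bar> \<le> 4 * (\<epsilon> * S j * (3 + ln (1 / \<epsilon>)))" for j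
    using rotation_column[OF cs, where \<epsilon> = \<epsilon> and ?x1.0 = "x1 j" and ?x2.0 = "x2 j" and ?y1.0 = "?v y1 j"
        and ?y2.0 = "?v y2 j" and ?e1.0 = "e1 j" and ?e2.0 = "e2 j" and ?d1.0 = "?v e1 j"
        and ?d2.0 = "?v e2 j"] eps
    unfolding G_def S_def eq by simp
  have G: "row_pot n F (\<lambda>k. c * x1 k + s * x2 k) (\<lambda>k. c * y1 k + s * y2 k)
        + row_pot n F (\<lambda>k. - s * x1 k + c * x2 k) (\<lambda>k. - s * y1 k + c * y2 k)
        - row_pot n F x1 y1 - row_pot n F x2 y2 = (\<Sum>j<n. G j)"
    unfolding row_pot_def G_def vmul_lin
    by (simp only: sum.distrib[symmetric] sum_subtractf[symmetric])
  have S0: "0 \<le> S j" for j unfolding S_def by simp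
  note ln2 = ln_inverse_ge_half[OF eps]
  have "(\<Sum>j<n. S j) = 2 * ((\<Sum>j<n. (x1 j)\<^sup>2) + (\<Sum>j<n. (x2 j)\<^sup>2) + (\<Sum>j<n. (?v y1 j)\<^sup>2)
     + (\<Sum>j<n. (?v y2 j)\<^sup>2) + ((\<Sum>j<n. (e1 j)\<^sup>2) + (\<Sum>j<n. (e2 j)\<^sup>2) + (\<Sum>j<n. (?v e1 j)\<^sup>2)
     + (\<Sum>j<n. (?v e2 j)\<^sup>2)) / \<epsilon>\<^sup>2)"
    unfolding S_def by (simp only: sum_distrib_left[symmetric] sum.distrib sum_divide_distrib[symmetric])
  also have "\<dots> \<le> 2 * (R + R + R + R + (\<epsilon>\<^sup>2 * R + \<epsilon>\<^sup>2 * R + \<epsilon>\<^sup>2 * R + \<epsilon>\<^sup>2 * R) / \<epsilon>\<^sup>2)"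
    unfolding vmul_parseval[OF F] using x y e eps
    by (intro mult_left_mono add_mono divide_right_mono) (auto simp: e1_def e2_def)
  also have "\<dots> = 16 * R" using eps by (simp add: field_simps)
  finally have SR: "(\<Sum>j<n. S j) \<le> 16 * R" .
  have "\<bar>\<Sum>j<n. G j\<bar> \<le> (\<Sum>j<n. 4 * (\<epsilon> * S j * (3 + ln (1 / \<epsilon>))))"
    using col by (intro order_trans[OF sum_abs] sum_mono)
  also have "\<dots> = 4 * \<epsilon> * (3 + ln (1 / \<epsilon>)) * (\<Sum>j<n. S j)"
    by (subst sum_distrib_left) (simp only: mult_ac)
  also have "\<dots> \<le> 4 * \<epsilon> * (7 * ln (1 / \<epsilon>)) * (16 * R)"
    using SR S0 eps ln2 by (intro mult_mono sum_nonneg) auto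
  finally show ?thesis unfolding G by (simp add: algebra_simps)
qed

subsection \<open>Well conditioned matrices\<close>

text \<open>Homogeneous form of the condition bound, free of suprema and infima; \<open>s\<close>
  plays the role of the least singular value.\<close>

definition near_iso :: "nat \<Rightarrow> rmat \<Rightarrow> real \<Rightarrow> bool" where
  "near_iso n M \<kappa> \<longleftrightarrow> (\<exists>s>0. \<forall>x. s * vnorm n x \<le> vnorm n (mvec n M x)
      \<and> vnorm n (mvec n M x) \<le> \<kappa> * s * vnorm n x)"

lemma vnorm_sq: "(vnorm n x)\<^sup>2 = (\<Sum>k<n. (x k)\<^sup>2)"
  by (simp add: vnorm_def sum_nonneg)

lemma vnorm_nonneg: "0 \<le> vnorm n x"
  by (simp add: vnorm_def sum_nonneg)

lemma vnorm_scale: "vnorm n (\<lambda>k. c * x k) = \<bar>c\<bar> * vnorm n x"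
  by (simp add: vnorm_def power_mult_distrib sum_distrib_left[symmetric] real_sqrt_mult)

lemma mvec_scale: "mvec n M (\<lambda>k. c * x k) = (\<lambda>a. c * mvec n M x a)"
  by (rule ext) (simp add: mvec_def sum_distrib_left algebra_simps)

text \<open>A crude bound whose purpose is that the supremum defining \<open>smax\<close> is taken
  over a bounded set.\<close>

lemma mvec_bounded:
  assumes "vnorm n x = 1"
  shows "vnorm n (mvec n M x) \<le> sqrt (\<Sum>a<n. (\<Sum>b<n. \<bar>M a b\<bar>)\<^sup>2)"
proof -
  have "\<bar>x b\<bar> \<le> 1" if "b < n" for b
  proof -
    have "(x b)\<^sup>2 \<le> (\<Sum>k<n. (x k)\<^sup>2)" using that by (intro member_le_sum) auto
    then show ?thesis using vnorm_sq[of n x] assms by (simp add: abs_square_le_1)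
  qed
  then have "\<bar>mvec n M x a\<bar> \<le> (\<Sum>b<n. \<bar>M a b\<bar>)" for a
    unfolding mvec_def
    by (intro order_trans[OF sum_abs] sum_mono) (auto simp: abs_mult intro!: mult_right_le_one_le)
  then have "(mvec n M x a)\<^sup>2 \<le> (\<Sum>b<n. \<bar>M a b\<bar>)\<^sup>2" for a
    by (metis abs_ge_zero power2_abs power_mono)
  then show ?thesis unfolding vnorm_def by (intro real_sqrt_le_mono sum_mono) auto
qed

lemma cond_le_near_iso:
  assumes "cond_le n M \<kappa>"
  shows "near_iso n M \<kappa>"
proof -
  let ?U = "(\<lambda>x. vnorm n (mvec n M x)) ` {x. vnorm n x = 1}"
  define s where "s = smin n M"
  have s: "0 < s" "smax n M \<le> \<kappa> * s" using assms by (auto simp: cond_le_def s_def)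
  have ba: "bdd_above ?U" using mvec_bounded[of n _ M] by (intro bdd_aboveI) auto
  have bb: "bdd_below ?U" using vnorm_nonneg by (intro bdd_belowI) auto
  have unit: "s \<le> vnorm n (mvec n M x)" "vnorm n (mvec n M x) \<le> \<kappa> * s" if "vnorm n x = 1" for x
  proof -
    show "s \<le> vnorm n (mvec n M x)"
      unfolding s_def smin_def using that by (intro cInf_lower bb) auto
    have "vnorm n (mvec n M x) \<le> smax n M"
      unfolding smax_def using that by (intro cSup_upper ba) auto
    then show "vnorm n (mvec n M x) \<le> \<kappa> * s" using s by linarith
  qed
  have "s * vnorm n x \<le> vnorm n (mvec n M x) \<and> vnorm n (mvec n M x) \<le> \<kappa> * s * vnorm n x" for x
  \<comment> \<open>Such an \<open>x\<close> cannot be normalized; it vanishes on the relevant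
    indices, so both bounds hold trivially.\<close>
  proof (cases "vnorm n x = 0")
    case True
    then have "(\<Sum>k<n. (x k)\<^sup>2) = 0" using vnorm_sq[of n x] by simp
    then have "\<And>k. k < n \<Longrightarrow> x k = 0" by (subst (asm) sum_nonneg_eq_0_iff) auto
    then have "vnorm n (mvec n M x) = 0" by (simp add: vnorm_def mvec_def)
    with True show ?thesis by simp
  next
    case False
    then have p: "0 < vnorm n x" using vnorm_nonneg[of n x] by simp
    have "vnorm n (\<lambda>k. (1 / vnorm n x) * x k) = 1" unfolding vnorm_scale using p by simp
    from unit[OF this] show ?thesis
      unfolding mvec_scale vnorm_scale using p by (simp add: field_simps)
  qed
  then show ?thesis unfolding near_iso_def using s by blast
qed

text \<open>With \<open>w\<close> a row of the inverse transpose and \<open>z = (M\<^sup>T M - s\<^sup>2) w\<close>, testing the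
  lower bound on \<open>w - z / q\<close> is the Cauchy--Schwarz inequality for the form
  \<open>M\<^sup>T M - s\<^sup>2\<close>; it bounds \<open>z\<close> to first order in \<open>\<kappa> - 1\<close>, whereas comparing row norms
  would only give the square root of that.\<close>
lemma row_deviation:
  assumes bi: "biorth n M N" and a: "a < n" and s: "0 < s" and k: "1 < \<kappa>"
    and lo: "\<And>x. s * vnorm n x \<le> vnorm n (mvec n M x)"
    and hi: "\<And>x. vnorm n (mvec n M x) \<le> \<kappa> * s * vnorm n x"
  defines "z \<equiv> \<lambda>k. M a k - s\<^sup>2 * N a k"
  shows "vnorm n (N a) \<le> 1 / s" "vnorm n z \<le> (\<kappa>\<^sup>2 - 1) * s"
proof -
  have sqlo: "s\<^sup>2 * (\<Sum>k<n. (x k)\<^sup>2) \<le> (\<Sum>k<n. (mvec n M x k)\<^sup>2)" for x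
    using power_mono[OF lo[of x], of 2] s vnorm_nonneg[of n x]
    by (simp add: power_mult_distrib vnorm_sq)
  have sqhi: "(\<Sum>k<n. (mvec n M x k)\<^sup>2) \<le> \<kappa>\<^sup>2 * s\<^sup>2 * (\<Sum>k<n. (x k)\<^sup>2)" for x
    using power_mono[OF hi[of x], of 2] vnorm_nonneg[of n "mvec n M x"]
    by (simp add: power_mult_distrib vnorm_sq)
  \<comment> \<open>Row \<open>a\<close> of \<open>N\<close> is column \<open>a\<close> of the
    inverse of \<open>M\<close>, hence is mapped to a unit vector. This is why \<open>z\<close>
    equals \<open>M\<^sup>T M - s\<^sup>2\<close> applied to \<open>N a\<close>.\<close>
  have Mw: "mvec n M (N a) b = idm b a" if "b < n" for b
    using bi a that by (simp add: mvec_def biorth_def)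
  define W Z where "W = (\<Sum>k<n. (N a k)\<^sup>2)" and "Z = (\<Sum>k<n. (z k)\<^sup>2)"
  define wz where "wz = (\<Sum>k<n. N a k * z k)"
  \<comment> \<open>By the upper bound \<open>hi\<close>, \<open>q\<close> bounds the form
    \<open>M\<^sup>T M - s\<^sup>2\<close> from above on unit vectors.\<close>
  define q where "q = (\<kappa>\<^sup>2 - 1) * s\<^sup>2"
  have q: "0 < q" using s k by (simp add: q_def one_less_power)
  have M1: "(\<Sum>k<n. (mvec n M (N a) k)\<^sup>2) = 1"
  proof -
    have "(\<Sum>k<n. (mvec n M (N a) k)\<^sup>2) = (\<Sum>k<n. idm k a * idm k a)"
      by (intro sum.cong refl) (simp add: Mw power2_eq_square)
    also have "\<dots> = 1" using a by (simp only: sum_idm) (simp add: idm_def)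
    finally show ?thesis .
  qed
  from sqlo[of "N a"] have W1: "s\<^sup>2 * W \<le> 1" unfolding M1 W_def .
  have "W \<le> (1 / s)\<^sup>2" using W1 s by (simp add: field_simps)
  then show "vnorm n (N a) \<le> 1 / s"
    unfolding W_def vnorm_sq[symmetric] using s by (auto intro: power2_le_imp_le)
  have MNa: "(\<Sum>k<n. M a k * N a k) = 1" using bi a by (simp add: biorth_def idm_def)
  have wz: "wz = 1 - s\<^sup>2 * W"
  proof -
    have "wz = (\<Sum>k<n. M a k * N a k) - s\<^sup>2 * W"
      by (simp add: wz_def z_def W_def sum_subtractf sum_distrib_left power2_eq_square algebra_simps)
    then show ?thesis by (simp add: MNa)
  qed
  have Mz: "mvec n M z a = (\<Sum>k<n. M a k * z k)" by (simp add: mvec_def)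
  have "Z = (\<Sum>k<n. M a k * z k) - s\<^sup>2 * wz"
    unfolding Z_def wz_def sum_distrib_left sum_subtractf[symmetric]
    by (intro sum.cong refl) (simp add: z_def power2_eq_square algebra_simps)
  then have Zeq: "Z = mvec n M z a - s\<^sup>2 * wz" by (simp only: Mz)
  define t where "t = 1 / q"
  have "s\<^sup>2 * (\<Sum>k<n. (N a k - t * z k)\<^sup>2) \<le> (\<Sum>k<n. (mvec n M (\<lambda>k. N a k - t * z k) k)\<^sup>2)"
    by (rule sqlo)
  also have "(\<Sum>k<n. (mvec n M (\<lambda>k. N a k - t * z k) k)\<^sup>2)
      = (\<Sum>k<n. (mvec n M (N a) k)\<^sup>2 - 2 * t * (idm k a * mvec n M z k) + t\<^sup>2 * (mvec n M z k)\<^sup>2)"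
  proof (intro sum.cong refl)
    fix k assume "k \<in> {..<n}"
    then have "mvec n M (N a) k = idm k a" by (simp add: Mw)
    moreover have "mvec n M (\<lambda>k. N a k - t * z k) k = mvec n M (N a) k - t * mvec n M z k"
      by (simp add: mvec_def sum_subtractf sum_distrib_left algebra_simps)
    ultimately show "(mvec n M (\<lambda>k. N a k - t * z k) k)\<^sup>2
        = (mvec n M (N a) k)\<^sup>2 - 2 * t * (idm k a * mvec n M z k) + t\<^sup>2 * (mvec n M z k)\<^sup>2"
      by (simp only: power2_diff power_mult_distrib) simp
  qed
  also have "\<dots> = 1 - 2 * t * mvec n M z a + t\<^sup>2 * (\<Sum>k<n. (mvec n M z k)\<^sup>2)"
    using a by (simp add: sum.distrib sum_subtractf sum_distrib_left[symmetric] M1)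
  also have "\<dots> \<le> 1 - 2 * t * mvec n M z a + t\<^sup>2 * (\<kappa>\<^sup>2 * s\<^sup>2 * Z)"
    unfolding Z_def by (intro add_left_mono mult_left_mono sqhi) auto
  finally have "s\<^sup>2 * (\<Sum>k<n. (N a k - t * z k)\<^sup>2)
      \<le> 1 - 2 * t * mvec n M z a + t\<^sup>2 * (\<kappa>\<^sup>2 * s\<^sup>2 * Z)" .
  moreover have "(\<Sum>k<n. (N a k - t * z k)\<^sup>2) = W - 2 * t * wz + t\<^sup>2 * Z"
    by (simp add: W_def Z_def wz_def power2_diff sum.distrib sum_subtractf sum_distrib_left
        power_mult_distrib algebra_simps)
  ultimately have "2 * t * Z \<le> 1 - s\<^sup>2 * W + t\<^sup>2 * (q * Z)"
    unfolding Zeq[THEN eq_diff_eq[THEN iffD1], symmetric] q_def by (simp add: algebra_simps)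
  moreover have "t\<^sup>2 * (q * Z) = t * Z" using q by (simp add: t_def power2_eq_square)
  \<comment> \<open>The left side is the value of the form at \<open>N a\<close>.\<close>
  moreover have "1 - s\<^sup>2 * W \<le> q * W"
    using sqhi[of "N a"] unfolding M1 W_def[symmetric] q_def by (simp add: algebra_simps)
  ultimately have "t * Z \<le> q * W" by linarith
  then have "Z \<le> q\<^sup>2 * W" using q by (simp add: t_def field_simps power2_eq_square)
  also have "\<dots> = ((\<kappa>\<^sup>2 - 1) * s)\<^sup>2 * (s\<^sup>2 * W)"
    by (simp add: q_def power_mult_distrib power2_eq_square algebra_simps)
  also have "\<dots> \<le> ((\<kappa>\<^sup>2 - 1) * s)\<^sup>2 * 1" using W1 by (intro mult_left_mono) auto
  finally have "(vnorm n z)\<^sup>2 \<le> ((\<kappa>\<^sup>2 - 1) * s)\<^sup>2" by (simp add: vnorm_sq Z_def)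
  moreover have "0 \<le> (\<kappa>\<^sup>2 - 1) * s" using s k by (simp add: one_le_power)
  ultimately show "vnorm n z \<le> (\<kappa>\<^sup>2 - 1) * s" by (rule power2_le_imp_le)
qed

subsection \<open>Cost of a single gate\<close>

lemma mmult_rot:
  assumes "i < n" "i' < n" "i \<noteq> i'" "a < n"
  shows "mmult n (rot i i' \<Theta>) A a b =
    (if a = i then cos \<Theta> * A i b + sin \<Theta> * A i' b
     else if a = i' then - sin \<Theta> * A i b + cos \<Theta> * A i' b else A a b)"
proof -
  have *: "(\<Sum>k<n. (if k = i then p else 0) + (if k = i' then q else 0)) = p + q" for p q :: real
    using assms by (simp add: sum.distrib)
  consider "a = i" | "a = i'" "a \<noteq> i" | "a \<noteq> i" "a \<noteq> i'" by blast
  then show ?thesis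
  proof cases
    case 1
    have "mmult n (rot i i' \<Theta>) A a b
        = (\<Sum>k<n. (if k = i then cos \<Theta> * A i b else 0) + (if k = i' then sin \<Theta> * A i' b else 0))"
      unfolding mmult_def using 1 assms by (intro sum.cong) (auto simp: rot_def)
    then show ?thesis using 1 * by simp
  next
    case 2
    have "mmult n (rot i i' \<Theta>) A a b
        = (\<Sum>k<n. (if k = i then - sin \<Theta> * A i b else 0) + (if k = i' then cos \<Theta> * A i' b else 0))"
      unfolding mmult_def using 2 assms by (intro sum.cong) (auto simp: rot_def)
    then show ?thesis using 2 * by simp
  next
    case 3
    have "mmult n (rot i i' \<Theta>) A a b = (\<Sum>k<n. idm k a * A k b)"
      unfolding mmult_def using 3 assms by (intro sum.cong) (auto simp: rot_def idm_def)
    then show ?thesis using 3 assms by simp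
  qed
qed

lemma biorth_comb:
  assumes "biorth n A N" "a < n" "a' < n" "b < n" "b' < n"
  shows "(\<Sum>k<n. (p * A a k + q * A a' k) * (p' * N b k + q' * N b' k))
    = p * p' * idm a b + p * q' * idm a b' + q * p' * idm a' b + q * q' * idm a' b'"
proof -
  have "(\<Sum>k<n. (p * A a k + q * A a' k) * (p' * N b k + q' * N b' k))
     = (\<Sum>k<n. p * p' * (A a k * N b k) + p * q' * (A a k * N b' k)
          + q * p' * (A a' k * N b k) + q * q' * (A a' k * N b' k))"
    by (simp add: algebra_simps)
  also have "\<dots> = p * p' * idm a b + p * q' * idm a b' + q * p' * idm a' b + q * q' * idm a' b'"
    using assms by (simp add: sum.distrib sum_distrib_left[symmetric] biorth_def)
  finally show ?thesis .
qed

text \<open>A rotation is its own inverse transpose, so \<open>N\<close> undergoes the same rotation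
  as \<open>A\<close>.\<close>

lemma biorth_rotate:
  assumes bi: "biorth n A N" and i: "i < n" "i' < n" "i \<noteq> i'"
  shows "biorth n (mmult n (rot i i' \<Theta>) A) (mmult n (rot i i' \<Theta>) N)"
proof -
  \<comment> \<open>Writing every row as a combination of row \<open>a\<close> and row
    \<open>\<sigma> a\<close> lets one bilinear formula treat all rows; an untouched row has
    \<open>q a = 0\<close>.\<close>
  define p where "p a = (if a = i \<or> a = i' then cos \<Theta> else 1)" for a
  define q where "q a = (if a = i then sin \<Theta> else if a = i' then - sin \<Theta> else 0)" for a
  define \<sigma> where "\<sigma> a = (if a = i then i' else if a = i' then i else a)" for a
  have row: "mmult n (rot i i' \<Theta>) M a b = p a * M a b + q a * M (\<sigma> a) b" if "a < n" for M a b
    using i that by (simp add: mmult_rot p_def q_def \<sigma>_def)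
  have \<sigma>: "\<sigma> a < n" if "a < n" for a using that i by (simp add: \<sigma>_def)
  have t: "cos \<Theta> * cos \<Theta> + sin \<Theta> * sin \<Theta> = 1" "sin \<Theta> * sin \<Theta> + cos \<Theta> * cos \<Theta> = 1"
    using sin_cos_squared_add3[of \<Theta>] by (simp_all add: algebra_simps)
  show ?thesis
    unfolding biorth_def
  proof (intro allI impI)
    fix a b assume ab: "a < n" "b < n"
    have "(\<Sum>k<n. mmult n (rot i i' \<Theta>) A a k * mmult n (rot i i' \<Theta>) N b k)
      = p a * p b * idm a b + p a * q b * idm a (\<sigma> b) + q a * p b * idm (\<sigma> a) b + q a * q b * idm (\<sigma> a) (\<sigma> b)"
      using ab \<sigma> by (simp add: row biorth_comb[OF bi])
    also have "\<dots> = idm a b"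
      using i t by (auto simp: p_def q_def \<sigma>_def idm_def)
    finally show "(\<Sum>k<n. mmult n (rot i i' \<Theta>) A a k * mmult n (rot i i' \<Theta>) N b k) = idm a b" .
  qed
qed

lemma biorth_meq: "biorth n A N \<Longrightarrow> meq n B A \<Longrightarrow> biorth n B N"
  by (simp add: biorth_def meq_def)

lemma pot_meq: "meq n B A \<Longrightarrow> pot n F B N = pot n F A N"
  unfolding pot_def meq_def by (intro sum.cong refl row_pot_cong) auto

text \<open>The factor after 448 bounds the squared norms of the normalized rows;
  \<open>2 * C + C\<^sup>2\<close> comes from
  \<open>\<kappa>\<^sup>2 - 1 \<le> \<epsilon> * (2 * C + C\<^sup>2)\<close> for
  \<open>\<kappa> = 1 + C * \<epsilon>\<close>.\<close>

definition step_cost :: "real \<Rightarrow> real \<Rightarrow> real" where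
  "step_cost C \<epsilon> = 448 * (2 + 2 * (2 * C + C\<^sup>2)\<^sup>2) * (\<epsilon> * ln (1 / \<epsilon>))"

text \<open>Only rows \<open>i\<close> and \<open>i'\<close> contribute. After rescaling to
  \<open>x = A / s\<close> and \<open>y = s * N\<close>, \<open>row_deviation\<close> supplies the
  hypotheses of \<open>row_pot_rotate\<close>. Only the conditioning before the gate enters.\<close>

lemma pot_rotate:
  assumes F: "biorth n F F" and bi: "biorth n A N" and eps: "0 < \<epsilon>" "\<epsilon> < 1/2" and C: "0 < C"
    and near: "near_iso n A (1 + C * \<epsilon>)" and i: "i < n" "i' < n" "i \<noteq> i'"
  shows "\<bar>pot n F (mmult n (rot i i' \<Theta>) A) (mmult n (rot i i' \<Theta>) N) - pot n F A N\<bar> \<le> step_cost C \<epsilon>"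
proof -
  define \<kappa> where "\<kappa> = 1 + C * \<epsilon>"
  define R where "R = 2 + 2 * (2 * C + C\<^sup>2)\<^sup>2"
  have k: "1 < \<kappa>" using eps C by (simp add: \<kappa>_def)
  obtain s where s: "0 < s" and lo: "\<And>x. s * vnorm n x \<le> vnorm n (mvec n A x)"
    and hi: "\<And>x. vnorm n (mvec n A x) \<le> \<kappa> * s * vnorm n x"
    using near unfolding near_iso_def \<kappa>_def by blast
  have "\<kappa>\<^sup>2 - 1 = \<epsilon> * (2 * C + C\<^sup>2 * \<epsilon>)"
    by (simp add: \<kappa>_def power2_eq_square algebra_simps)
  also have "\<dots> \<le> \<epsilon> * (2 * C + C\<^sup>2 * 1)"
    using eps by (intro mult_left_mono add_left_mono) auto
  finally have kk: "\<kappa>\<^sup>2 - 1 \<le> \<epsilon> * (2 * C + C\<^sup>2)" by simp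
  have k0: "0 \<le> \<kappa>\<^sup>2 - 1" using k by (simp add: one_le_power)
  define r where "r = (2 * C + C\<^sup>2)\<^sup>2"
  have r: "0 \<le> r" "R = 2 + 2 * r" by (simp_all add: r_def R_def)
  define x where "x a k = (1 / s) * A a k" for a k
  define y where "y a k = s * N a k" for a k
  have rows: "(\<Sum>j<n. (x a j)\<^sup>2) \<le> R" "(\<Sum>j<n. (y a j)\<^sup>2) \<le> R"
    "(\<Sum>j<n. (x a j - y a j)\<^sup>2) \<le> \<epsilon>\<^sup>2 * R" if a: "a < n" for a
  proof -
    note d = row_deviation[OF bi a s k lo hi]
    have "vnorm n (y a) \<le> 1"
      unfolding y_def vnorm_scale using d(1) s by (simp add: field_simps)
    from power_mono[OF this, of 2] have y1: "(\<Sum>j<n. (y a j)\<^sup>2) \<le> 1"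
      by (simp add: vnorm_nonneg vnorm_sq)
    have xy: "x a j - y a j = (1 / s) * (A a j - s\<^sup>2 * N a j)" for j
      using s by (simp add: x_def y_def field_simps power2_eq_square)
    have "vnorm n (\<lambda>j. x a j - y a j) \<le> \<kappa>\<^sup>2 - 1"
      unfolding xy vnorm_scale using d(2) s by (simp add: field_simps)
    then have "vnorm n (\<lambda>j. x a j - y a j) \<le> \<epsilon> * (2 * C + C\<^sup>2)" using kk by linarith
    from power_mono[OF this, of 2] have e1: "(\<Sum>j<n. (x a j - y a j)\<^sup>2) \<le> \<epsilon>\<^sup>2 * r"
      by (simp add: vnorm_nonneg vnorm_sq power_mult_distrib r_def)
    show "(\<Sum>j<n. (y a j)\<^sup>2) \<le> R" using y1 r by simp
    have "\<epsilon>\<^sup>2 * r \<le> \<epsilon>\<^sup>2 * R" using r by (intro mult_left_mono) auto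
    then show "(\<Sum>j<n. (x a j - y a j)\<^sup>2) \<le> \<epsilon>\<^sup>2 * R" using e1 by linarith
    \<comment> \<open>The norm of \<open>x\<close> is controlled through
      \<open>x = y + (x - y)\<close>.\<close>
    have "(x a j)\<^sup>2 \<le> 2 * (y a j)\<^sup>2 + 2 * (x a j - y a j)\<^sup>2" for j
      using sum_squares_bound[of "y a j" "x a j - y a j"] power2_sum[of "y a j" "x a j - y a j"] by simp
    then have "(\<Sum>j<n. (x a j)\<^sup>2) \<le> (\<Sum>j<n. 2 * (y a j)\<^sup>2 + 2 * (x a j - y a j)\<^sup>2)"
      by (intro sum_mono)
    also have "\<dots> = 2 * (\<Sum>j<n. (y a j)\<^sup>2) + 2 * (\<Sum>j<n. (x a j - y a j)\<^sup>2)"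
      by (simp add: sum.distrib sum_distrib_left)
    also have "\<dots> \<le> 2 * 1 + 2 * (\<epsilon>\<^sup>2 * r)" using y1 e1 by linarith
    also have "\<dots> \<le> R"
      using r eps mult_left_le_one_le[of r "\<epsilon>\<^sup>2"] by (simp add: power_le_one)
    finally show "(\<Sum>j<n. (x a j)\<^sup>2) \<le> R" .
  qed
  let ?c = "cos \<Theta>" and ?s = "sin \<Theta>"
  let ?A = "mmult n (rot i i' \<Theta>) A" and ?N = "mmult n (rot i i' \<Theta>) N"
  let ?d = "\<lambda>a. row_pot n F (?A a) (?N a) - row_pot n F (A a) (N a)"
  have scale: "row_pot n F a b = row_pot n F (\<lambda>k. (1 / s) * a k) (\<lambda>k. s * b k)" for a b
    using row_pot_scale[of "1 / s" n F a b] s by simp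
  have old: "row_pot n F (A a) (N a) = row_pot n F (x a) (y a)" for a
    unfolding x_def y_def by (rule scale)
  have 1: "row_pot n F (?A i) (?N i)
      = row_pot n F (\<lambda>k. ?c * x i k + ?s * x i' k) (\<lambda>k. ?c * y i k + ?s * y i' k)"
    by (subst scale, rule row_pot_cong) (use i in \<open>simp_all add: mmult_rot x_def y_def algebra_simps add_divide_distrib\<close>)
  have 2: "row_pot n F (?A i') (?N i')
      = row_pot n F (\<lambda>k. - ?s * x i k + ?c * x i' k) (\<lambda>k. - ?s * y i k + ?c * y i' k)"
    by (subst scale, rule row_pot_cong) (use i in \<open>simp_all add: mmult_rot x_def y_def algebra_simps diff_divide_distrib\<close>)
  have rest: "?d a = 0" if "a \<in> {..<n} - {i, i'}" for a
  proof -
    have "row_pot n F (?A a) (?N a) = row_pot n F (A a) (N a)"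
      using that i by (intro row_pot_cong) (auto simp: mmult_rot)
    then show ?thesis by simp
  qed
  have "pot n F ?A ?N - pot n F A N = (\<Sum>a<n. ?d a)"
    by (simp add: pot_def sum_subtractf)
  also have "\<dots> = (\<Sum>a\<in>{i, i'}. ?d a)"
    using i rest by (intro sum.mono_neutral_right) auto
  also have "\<dots> = row_pot n F (\<lambda>k. ?c * x i k + ?s * x i' k) (\<lambda>k. ?c * y i k + ?s * y i' k)
     + row_pot n F (\<lambda>k. - ?s * x i k + ?c * x i' k) (\<lambda>k. - ?s * y i k + ?c * y i' k)
     - row_pot n F (x i) (y i) - row_pot n F (x i') (y i')"
    using i(3) by (simp only: 1[symmetric] 2[symmetric] old[symmetric]) simp
  finally show ?thesis
    unfolding step_cost_def R_def[symmetric]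
    using row_pot_rotate[OF F eps cos_squared_eq[THEN eq_diff_eq[THEN iffD1]] rows(1)[OF i(1)] rows(1)[OF i(2)]
        rows(2)[OF i(1)] rows(2)[OF i(2)] rows(3)[OF i(1)] rows(3)[OF i(2)], of \<Theta>] by simp
qed

lemma pot_step:
  assumes F: "biorth n F F" and bi: "biorth n A N" and eps: "0 < \<epsilon>" "\<epsilon> < 1/2" and C: "0 < C"
    and near: "near_iso n A (1 + C * \<epsilon>)" and st: "alg_step n A B"
  shows "\<exists>N'. biorth n B N' \<and> \<bar>pot n F B N' - pot n F A N\<bar> \<le> step_cost C \<epsilon>"
  using st unfolding alg_step_def
proof (elim disjE exE conjE)
  fix i c assume i: "i < n" and c: "(c::real) \<noteq> 0"
    and B: "meq n B (\<lambda>a b. if a = i then c * A a b else A a b)"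
  define B' where "B' = (\<lambda>a b. if a = i then c * A a b else A a b)"
  \<comment> \<open>Scaling a row by \<open>c\<close> scales the same row of the inverse transpose
    by \<open>1 / c\<close>.\<close>
  define N' where "N' = (\<lambda>a b. if a = i then (1 / c) * N a b else N a b)"
  have "biorth n B' N'"
    unfolding biorth_def
  proof (intro allI impI)
    fix a b assume ab: "a < n" "b < n"
    have "(\<Sum>k<n. B' a k * N' b k)
      = (\<Sum>k<n. (if a = i then c else 1) * (if b = i then 1 / c else 1) * (A a k * N b k))"
      by (intro sum.cong refl) (simp add: B'_def N'_def)
    also have "\<dots> = (if a = i then c else 1) * (if b = i then 1 / c else 1) * idm a b"
      using bi ab by (simp only: sum_distrib_left[symmetric]) (simp add: biorth_def)
    also have "\<dots> = idm a b" using c by (auto simp: idm_def)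
    finally show "(\<Sum>k<n. B' a k * N' b k) = idm a b" .
  qed
  then have bi': "biorth n B N'" using B biorth_meq unfolding B'_def by blast
  have "row_pot n F (B' a) (N' a) = row_pot n F (A a) (N a)" for a
    using row_pot_scale[OF c] by (cases "a = i") (simp_all add: B'_def N'_def)
  then have "pot n F B N' = pot n F A N"
    using pot_meq[OF B] unfolding B'_def[symmetric] by (simp add: pot_def)
  moreover have "0 \<le> step_cost C \<epsilon>" unfolding step_cost_def using eps by simp
  ultimately show ?thesis using bi' by auto
next
  fix i i' \<Theta> assume i: "i < n" "i' < n" "i \<noteq> i'" and B: "meq n B (mmult n (rot i i' \<Theta>) A)"
  show ?thesis
    using pot_rotate[OF F bi eps C near i, of \<Theta>] biorth_meq[OF biorth_rotate[OF bi i] B] pot_meq[OF B]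
    by auto
qed

section \<open>Accumulated change of the potential along an algorithm\<close>

lemma near_iso_idm:
  assumes "meq n M idm" "1 \<le> \<kappa>"
  shows "near_iso n M \<kappa>"
proof -
  have "mvec n M x a = x a" if "a < n" for x a
  proof -
    have "mvec n M x a = (\<Sum>b<n. x b * idm a b)"
      unfolding mvec_def using assms that by (intro sum.cong) (auto simp: meq_def)
    then show ?thesis using that by simp
  qed
  then have "vnorm n (mvec n M x) = vnorm n x" for x by (simp add: vnorm_def)
  then show ?thesis
    unfolding near_iso_def using assms vnorm_nonneg[of n]
    by (intro exI[of _ 1]) (simp add: mult_right_mono[of 1 \<kappa>, simplified])
qed

lemma algorithm_pot_bound:
  assumes F: "biorth n F F" and eps: "0 < \<epsilon>" "\<epsilon> < 1/2" and C: "0 < C"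
    and alg: "is_algorithm n Ms" and wc: "well_conditioned n (1 + C * \<epsilon>) Ms"
  shows "t < length Ms \<Longrightarrow> \<exists>N. biorth n (Ms ! t) N \<and> \<bar>pot n F (Ms ! t) N\<bar> \<le> real t * step_cost C \<epsilon>"
proof (induction t)
  case 0
  have M0: "meq n (Ms ! 0) idm" using alg by (simp add: is_algorithm_def)
  have "biorth n idm idm" by (simp add: biorth_def) (simp add: idm_def)
  then have "biorth n (Ms ! 0) idm" using M0 biorth_meq by blast
  \<comment> \<open>For equal \<open>M\<close> and \<open>N\<close> the two products in each entry
    coincide.\<close>
  moreover have "pot n F (Ms ! 0) idm = 0"
    unfolding pot_meq[OF M0] by (simp add: pot_def row_pot_def mult.commute)
  ultimately show ?case by auto
next
  case (Suc t)
  then obtain N where N: "biorth n (Ms ! t) N" "\<bar>pot n F (Ms ! t) N\<bar> \<le> real t * step_cost C \<epsilon>" by auto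
  have near: "near_iso n (Ms ! t) (1 + C * \<epsilon>)"
  \<comment> \<open>\<open>well_conditioned\<close> speaks of the indices from 1 on, so the initial
    identity matrix is treated apart.\<close>
  proof (cases "t = 0")
    case True
    then show ?thesis using alg eps C by (intro near_iso_idm) (auto simp: is_algorithm_def)
  next
    case False
    then show ?thesis using wc Suc.prems
      by (intro cond_le_near_iso) (auto simp: well_conditioned_def)
  qed
  have "\<forall>u. 1 \<le> u \<and> u < length Ms \<longrightarrow> alg_step n (Ms ! (u - 1)) (Ms ! u)"
    using alg by (simp add: is_algorithm_def)
  from this[rule_format, of "Suc t"] have "alg_step n (Ms ! t) (Ms ! Suc t)" using Suc.prems by simp
  from pot_step[OF F N(1) eps C near this] obtain N' where "biorth n (Ms ! Suc t) N'"
    "\<bar>pot n F (Ms ! Suc t) N' - pot n F (Ms ! t) N\<bar> \<le> step_cost C \<epsilon>"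
    by blast
  moreover have "real (Suc t) * step_cost C \<epsilon> = real t * step_cost C \<epsilon> + step_cost C \<epsilon>"
    by (simp add: algebra_simps)
  ultimately show ?case using N(2) by (intro exI[of _ N']) auto
qed

subsection \<open>The Walsh--Hadamard matrix\<close>

lemma walsh_sym: "walsh n i j = walsh n j i"
  by (simp add: walsh_def conj_commute)

lemma walsh_sq: "0 < n \<Longrightarrow> walsh n i j * walsh n i j = 1 / n"
  by (simp add: walsh_def)

lemma abs_walsh: "\<bar>walsh n i j\<bar> = 1 / sqrt n"
  by (simp add: walsh_def power_abs)

text \<open>As a product over digits, the sign responds to flipping one digit through a single
  factor.\<close>

lemma walsh_prod:
  "walsh n i j = (\<Prod>b<n. if bit i b \<and> bit j b then - 1 else 1) / sqrt n"
proof -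
  have "(\<Prod>b<n. if bit i b \<and> bit j b then - 1 else (1::real)) = (- 1) ^ card {b. b < n \<and> bit i b \<and> bit j b}"
    by (subst prod.If_cases) (auto intro!: arg_cong[where f = "\<lambda>S. (- 1) ^ card S"])
  then show ?thesis by (simp add: walsh_def)
qed

lemma walsh_flip:
  assumes "p < n"
  shows "walsh n a (flip_bit p j) = (if bit a p then - 1 else 1) * walsh n a j"
proof -
  let ?f = "\<lambda>j b. if bit a b \<and> bit j b then - 1 else (1::real)"
  have rest: "prod (?f (flip_bit p j)) ({..<n} - {p}) = prod (?f j) ({..<n} - {p})"
    by (intro prod.cong) (auto simp: bit_flip_bit_iff)
  have fp: "?f (flip_bit p j) p = (if bit a p then - 1 else 1) * ?f j p"
    by (simp add: bit_flip_bit_iff)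
  have split: "prod (?f j) {..<n} = ?f j p * prod (?f j) ({..<n} - {p})" for j
    using assms by (intro prod.remove) auto
  have "prod (?f (flip_bit p j)) {..<n} = (if bit a p then - 1 else 1) * prod (?f j) {..<n}"
    unfolding split[of "flip_bit p j"] split[of j] fp rest by (rule mult.assoc)
  then show ?thesis unfolding walsh_prod by simp
qed

text \<open>Distinct \<open>a\<close> and \<open>b\<close> differ in some digit \<open>p\<close>;
  flipping that digit of \<open>j\<close> is an involution of the index range that negates each
  summand, so the sum equals its own negative.\<close>

lemma biorth_walsh:
  assumes n: "n = 2 ^ k"
  shows "biorth n (walsh n) (walsh n)"
  unfolding biorth_def
proof (intro allI impI)
  fix a b assume ab: "a < n" "b < n"
  show "(\<Sum>j<n. walsh n a j * walsh n b j) = idm a b"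
  proof (cases "a = b")
    case True
    then show ?thesis using n by (simp add: walsh_sq idm_def)
  next
    case False
    then obtain p where p: "bit a p \<noteq> bit b p" by (meson bit_eqI)
    have "p < k"
    proof (rule ccontr)
      assume "\<not> p < k"
      then have "\<not> bit (take_bit k a) p" "\<not> bit (take_bit k b) p" by (simp_all add: bit_take_bit_iff)
      moreover have "take_bit k a = a" "take_bit k b = b"
        using ab n by (simp_all add: take_bit_nat_eq_self)
      ultimately show False using p by simp
    qed
    \<comment> \<open>\<open>p < k\<close> keeps flipped indices below \<open>n\<close>;
      \<open>p < n\<close> is also required because \<open>walsh\<close> ranges over all digit
      positions below \<open>n\<close>.\<close>
    from less_trans[OF this less_exp[of k]] have "p < n" by (simp only: n)
    have flip: "flip_bit p j < n" if "j < n" for j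
    proof -
      have "take_bit k (flip_bit p j) = flip_bit p j"
        using that n \<open>p < k\<close> by (simp add: take_bit_flip_bit_eq take_bit_nat_eq_self)
      then show ?thesis using n by (metis take_bit_nat_less_exp)
    qed
    have ff: "flip_bit p (flip_bit p j) = j" for j :: nat
      by (rule bit_eqI) (auto simp: bit_flip_bit_iff)
    have "(\<Sum>j<n. walsh n a j * walsh n b j)
        = (\<Sum>j<n. walsh n a (flip_bit p j) * walsh n b (flip_bit p j))"
      by (rule sum.reindex_bij_witness[of _ "flip_bit p" "flip_bit p"]) (auto simp: ff flip)
    also have "\<dots> = (\<Sum>j<n. - (walsh n a j * walsh n b j))"
      using p \<open>p < n\<close> by (intro sum.cong refl) (auto simp: walsh_flip)
    finally have "(\<Sum>j<n. walsh n a j * walsh n b j) = 0" by (simp add: sum_negf)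
    then show ?thesis using False by (simp add: idm_def)
  qed
qed

section \<open>Lower bound for the potential at the perturbed identity\<close>

lemma ent_small:
  assumes "0 < \<epsilon>" "\<epsilon> < 1/2" "\<bar>p\<bar> \<le> 4 * \<epsilon>"
  shows "\<bar>ent p\<bar> \<le> 28 * (\<epsilon> * ln (1 / \<epsilon>))"
proof -
  note L = ln_inverse_ge_half[OF assms(1,2)]
  \<comment> \<open>Comparison with 0 at scale \<open>B = 2\<close>, admissible since
    \<open>4 * \<epsilon> < 2\<close>.\<close>
  have "\<bar>ent p - ent 0 + (p - 0) * ln 2\<bar> \<le> \<bar>p - 0\<bar> * (1 + ln (1 / \<epsilon>)) + 2 * \<epsilon> * 2"
    using assms by (intro ent_modulus) auto
  moreover have "\<bar>p * ln 2\<bar> \<le> \<bar>p\<bar> * 1"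
    unfolding abs_mult using ln_2_less_1 by (intro mult_left_mono) auto
  ultimately have "\<bar>ent p\<bar> \<le> \<bar>p\<bar> * (2 + ln (1 / \<epsilon>)) + 4 * \<epsilon>"
    by (simp add: algebra_simps)
  also have "\<dots> \<le> 4 * \<epsilon> * (2 + ln (1 / \<epsilon>)) + 4 * \<epsilon>"
    using assms L by (intro add_right_mono mult_right_mono) auto
  also have "\<dots> = 4 * \<epsilon> * (3 + ln (1 / \<epsilon>))" by (simp add: algebra_simps)
  also have "\<dots> \<le> 4 * \<epsilon> * (7 * ln (1 / \<epsilon>))" using assms L by (intro mult_left_mono) auto
  finally show ?thesis by simp
qed

text \<open>A left inverse \<open>G\<close> of \<open>X\<close> agrees with the right inverse
  \<open>N\<^sup>T\<close>, by evaluating \<open>G X N\<^sup>T\<close> in two ways.\<close>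

lemma biorth_unique:
  assumes "biorth n X N" and G: "\<And>a b. a < n \<Longrightarrow> b < n \<Longrightarrow> (\<Sum>k<n. G a k * X k b) = idm a b"
    and ab: "a < n" "b < n"
  shows "N b a = G a b"
proof -
  have "N b a = (\<Sum>k<n. N b k * idm a k)" using ab by simp
  also have "\<dots> = (\<Sum>k<n. \<Sum>l<n. G a l * (X l k * N b k))"
    using ab by (intro sum.cong refl) (simp add: G[symmetric] sum_distrib_left mult_ac)
  also have "\<dots> = (\<Sum>l<n. G a l * (\<Sum>k<n. X l k * N b k))"
    by (subst sum.swap) (simp add: sum_distrib_left)
  also have "\<dots> = (\<Sum>l<n. G a l * idm l b)"
    using assms(1) ab by (intro sum.cong refl) (simp add: biorth_def)
  finally show ?thesis using ab by simp
qed

text \<open>As \<open>F\<close> is a symmetric involution, the inverse transpose is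
  \<open>(Id - \<epsilon> F) / (1 - \<epsilon>\<^sup>2)\<close>. In each row the off-diagonal terms
  give at least \<open>\<epsilon> * ln n\<close>, while the diagonal term loses at most
  \<open>56 * \<epsilon> * ln (1 / \<epsilon>)\<close>; the hypothesis with 112 makes this at most
  half of the gain.\<close>

lemma pot_perturbation:
  fixes \<epsilon> :: real
  assumes n: "n = 2 ^ k" "2 \<le> n" and eps: "0 < \<epsilon>" "\<epsilon> < 1/2"
    and big: "112 * ln (1 / \<epsilon>) \<le> ln n"
    and bi: "biorth n (\<lambda>i j. idm i j + \<epsilon> * walsh n i j) N"
  shows "real n * (\<epsilon> * ln n) / 2 \<le> pot n (walsh n) (\<lambda>i j. idm i j + \<epsilon> * walsh n i j) N"
proof -
  define W where "W = walsh n"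
  define \<delta> where "\<delta> = 1 - \<epsilon>\<^sup>2"
  have "\<epsilon>\<^sup>2 \<le> (1/2)\<^sup>2" using eps by (intro power_mono) auto
  then have \<delta>: "3 / 4 \<le> \<delta>" "\<delta> \<le> 1" by (simp_all add: \<delta>_def power2_eq_square)
  define X where "X i j = idm i j + \<epsilon> * W i j" for i j
  define G where "G i j = (idm i j - \<epsilon> * W i j) / \<delta>" for i j
  have W2: "(\<Sum>k<n. W a k * W k b) = idm a b" if "a < n" "b < n" for a b
    using biorth_walsh[OF n(1)] that walsh_sym[of n _ b] by (simp add: W_def biorth_def)
  have GX: "(\<Sum>k<n. G a k * X k b) = idm a b" if ab: "a < n" "b < n" for a b
  proof -
    have "(\<Sum>k<n. G a k * X k b) = ((\<Sum>k<n. idm a k * idm k b) + \<epsilon> * (\<Sum>k<n. W k b * idm a k)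
        - \<epsilon> * (\<Sum>k<n. W a k * idm k b) - \<epsilon>\<^sup>2 * (\<Sum>k<n. W a k * W k b)) / \<delta>"
      by (simp add: G_def X_def sum_distrib_left sum_divide_distrib sum_subtractf[symmetric]
          sum.distrib[symmetric] power2_eq_square algebra_simps add_divide_distrib diff_divide_distrib)
    also have "\<dots> = (idm a b - \<epsilon>\<^sup>2 * idm a b) / \<delta>" using ab by (simp add: W2)
    also have "\<dots> = idm a b" using \<delta> by (simp add: \<delta>_def field_simps)
    finally show ?thesis .
  qed
  have Geq: "N i j = G i j" if "i < n" "j < n" for i j
  proof -
    have "N i j = G j i" using biorth_unique[OF _ GX, of N] bi that unfolding X_def W_def by blast
    then show ?thesis by (simp add: G_def idm_def W_def walsh_sym[of n j i] eq_commute)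
  qed
  have vN: "vmul n W (N i) j = (W i j - \<epsilon> * idm i j) / \<delta>" if ij: "i < n" "j < n" for i j
  proof -
    have "vmul n W (N i) j = (\<Sum>k<n. (W k j * idm i k - \<epsilon> * (W i k * W k j)) / \<delta>)"
      unfolding vmul_def using ij by (intro sum.cong refl) (simp add: Geq G_def algebra_simps)
    also have "\<dots> = ((\<Sum>k<n. W k j * idm i k) - \<epsilon> * (\<Sum>k<n. W i k * W k j)) / \<delta>"
      by (simp only: sum_divide_distrib[symmetric] sum_subtractf sum_distrib_left)
    finally show ?thesis using ij by (simp add: W2)
  qed
  have vX: "vmul n W (X i) j = W i j + \<epsilon> * idm i j" if ij: "i < n" "j < n" for i j
  proof -
    have "vmul n W (X i) j = (\<Sum>k<n. W k j * idm i k + \<epsilon> * (W i k * W k j))"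
      unfolding vmul_def by (intro sum.cong refl) (simp add: X_def algebra_simps)
    also have "\<dots> = (\<Sum>k<n. W k j * idm i k) + \<epsilon> * (\<Sum>k<n. W i k * W k j)"
      by (simp only: sum.distrib sum_distrib_left)
    finally show ?thesis using ij by (simp add: W2)
  qed
  define L where "L = ln (1 / \<epsilon>)"
  define g where "g i j = ent (X i j * vmul n W (N i) j) - ent (vmul n W (X i) j * N i j)" for i j
  have lnn: "0 \<le> ln n" using n(2) by simp
  have off: "2 * (\<epsilon> / n * ln n) \<le> g i j" if ij: "i < n" "j < n" "i \<noteq> j" for i j
  proof -
    define \<rho> where "\<rho> = \<epsilon> / \<delta> / n"
    \<comment> \<open>The two arguments of \<open>ent\<close> are opposite and \<open>ent\<close> is
      odd, so subtracting doubles the contribution.\<close>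
    have "X i j * vmul n W (N i) j = \<epsilon> * (W i j * W i j) / \<delta>"
      "vmul n W (X i) j * N i j = - (\<epsilon> * (W i j * W i j) / \<delta>)"
      using ij by (simp_all add: X_def vN vX Geq G_def idm_def)
    moreover have "\<epsilon> * (W i j * W i j) / \<delta> = \<rho>"
      using n(2) by (simp add: \<rho>_def W_def walsh_sq)
    ultimately have g: "g i j = 2 * ent \<rho>" by (simp add: g_def)
    have "\<epsilon> / 1 \<le> \<epsilon> / \<delta>" using \<delta> eps by (intro divide_left_mono) auto
    then have r1: "\<epsilon> / n \<le> \<rho>" unfolding \<rho>_def by (intro divide_right_mono) auto
    have "\<epsilon> / \<delta> \<le> 1" using \<delta> eps by simp
    then have r2: "\<rho> \<le> 1 / n" unfolding \<rho>_def by (intro divide_right_mono) auto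
    have r0: "0 < \<rho>" using \<delta> eps n(2) by (simp add: \<rho>_def)
    have "ln \<rho> \<le> ln (1 / n)" using r0 r2 by (intro ln_mono) auto
    also have "\<dots> = - ln n" using n(2) by (simp add: ln_div)
    finally have "ln n \<le> - ln \<rho>" by linarith
    then have "\<epsilon> / n * ln n \<le> \<rho> * (- ln \<rho>)" using r0 r1 lnn by (intro mult_mono) auto
    then show ?thesis using r0 g by (simp add: ent_def)
  qed
  have diag: "- (56 * (\<epsilon> * L)) \<le> g i i" if i: "i < n" for i
  proof -
    define w where "w = W i i"
    \<comment> \<open>This gives \<open>1 / sqrt n \<le> \<epsilon>\<close>, so that the diagonal
      entry of \<open>F\<close> does not exceed \<open>\<epsilon>\<close> and both diagonal products
      are at most \<open>4 * \<epsilon>\<close>.\<close>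
    have "ln (1 / \<epsilon>) \<le> ln n / 2" using big ln_inverse_ge_half[OF eps] by linarith
    also have "\<dots> = ln (sqrt n)" using n(2) by (simp add: ln_sqrt)
    finally have "1 / \<epsilon> \<le> sqrt n" using eps n(2) by simp
    then have w: "\<bar>w\<bar> \<le> \<epsilon>" using eps n(2) unfolding w_def W_def abs_walsh by (simp add: field_simps)
    have bd: "\<bar>u * v / \<delta>\<bar> \<le> 4 * \<epsilon>" if "\<bar>u\<bar> \<le> 2 * \<epsilon>" "\<bar>v\<bar> \<le> 3 / 2" for u v
    proof -
      have "\<bar>u\<bar> * \<bar>v\<bar> / \<delta> \<le> (2 * \<epsilon>) * (3 / 2) / (3 / 4)"
        using that \<delta> eps by (intro frac_le mult_mono) auto
      then show ?thesis using \<delta> by (simp add: abs_mult)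
    qed
    have "\<epsilon> * \<bar>w\<bar> \<le> (1/2) * 1" using w eps by (intro mult_mono) auto
    then have ew: "\<bar>\<epsilon> * w\<bar> \<le> 1 / 2" using eps by (simp add: abs_mult)
    have "X i i * vmul n W (N i) i = (w - \<epsilon>) * (1 + \<epsilon> * w) / \<delta>"
      "vmul n W (X i) i * N i i = (w + \<epsilon>) * (1 - \<epsilon> * w) / \<delta>"
      using i by (simp_all add: X_def vN vX Geq G_def idm_def w_def)
    then have "\<bar>X i i * vmul n W (N i) i\<bar> \<le> 4 * \<epsilon>" "\<bar>vmul n W (X i) i * N i i\<bar> \<le> 4 * \<epsilon>"
      using bd[of "w - \<epsilon>" "1 + \<epsilon> * w"] bd[of "w + \<epsilon>" "1 - \<epsilon> * w"] w ew by auto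
    from this[THEN ent_small[OF eps]] show ?thesis by (simp add: g_def L_def)
  qed
  have row: "\<epsilon> * ln n / 2 \<le> (\<Sum>j<n. g i j)" if i: "i < n" for i
  proof -
    have "(\<Sum>j<n. g i j) = g i i + (\<Sum>j\<in>{..<n} - {i}. g i j)" using i by (intro sum.remove) auto
    moreover have "(\<Sum>j\<in>{..<n} - {i}. 2 * (\<epsilon> / n * ln n)) \<le> (\<Sum>j\<in>{..<n} - {i}. g i j)"
      using i off by (intro sum_mono) auto
    moreover have "(\<Sum>j\<in>{..<n} - {i}. 2 * (\<epsilon> / n * ln n)) = (2 * (real n - 1) / n) * (\<epsilon> * ln n)"
      using i n(2) by (simp add: of_nat_diff)
    \<comment> \<open>\<open>2 * (n - 1) / n \<ge> 1\<close> is where \<open>n \<ge> 2\<close>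
      enters.\<close>
    moreover have "1 * (\<epsilon> * ln n) \<le> (2 * (real n - 1) / n) * (\<epsilon> * ln n)"
      using n(2) eps lnn by (intro mult_right_mono) (auto simp: field_simps)
    moreover have "56 * (\<epsilon> * L) \<le> \<epsilon> * ln n / 2"
    proof -
      have "\<epsilon> * (112 * L) \<le> \<epsilon> * ln n" using big eps by (simp add: L_def)
      then show ?thesis by simp
    qed
    ultimately show ?thesis using diag[OF i] by linarith
  qed
  have "real n * (\<epsilon> * ln n) / 2 = (\<Sum>i<n. \<epsilon> * ln n / 2)" by simp
  also have "\<dots> \<le> (\<Sum>i<n. \<Sum>j<n. g i j)" using row by (intro sum_mono) auto
  also have "\<dots> = pot n W X N" by (simp add: pot_def row_pot_def g_def)
  finally show ?thesis unfolding X_def W_def .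
qed

theorem theorem4p1:
  fixes eps :: "nat \<Rightarrow> real"
  assumes "\<forall>n. 0 < eps n \<and> eps n < 1/2"
    and "(\<lambda>n. ln (1 / eps n)) \<in> o(\<lambda>n. ln (real n))"
  shows "\<forall>C>0. \<exists>c>0. \<exists>n0::nat. \<forall>n\<ge>n0. \<forall>k::nat. n = 2 ^ k \<longrightarrow>
           (\<forall>Ms. is_algorithm n Ms
                 \<and> computes n Ms (\<lambda>i j. idm i j + eps n * walsh n i j)
                 \<and> well_conditioned n (1 + C * eps n) Ms
                 \<longrightarrow> real (length Ms - 1) \<ge> c * (real n * log 2 (real n)) / log 2 (1 / eps n))"
proof (intro allI impI)
  fix C :: real assume C: "0 < C"
  \<comment> \<open>The little-o hypothesis is instantiated at the ratio that
    \<open>pot_perturbation\<close> demands.\<close>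
  have "\<forall>\<^sub>F n in sequentially. norm (ln (1 / eps n)) \<le> (1 / 112) * norm (ln (real n))"
    using assms(2) by (rule landau_o.smallD) simp
  then obtain n1 where n1: "\<And>n. n1 \<le> n \<Longrightarrow> \<bar>ln (1 / eps n)\<bar> \<le> (1 / 112) * \<bar>ln (real n)\<bar>"
    by (auto simp: eventually_at_top_linorder)
  define K where "K = 448 * (2 + 2 * (2 * C + C\<^sup>2)\<^sup>2)"
  have K: "0 < K" unfolding K_def by (intro mult_pos_pos add_pos_nonneg) auto
  show "\<exists>c>0. \<exists>n0::nat. \<forall>n\<ge>n0. \<forall>k::nat. n = 2 ^ k \<longrightarrow>
           (\<forall>Ms. is_algorithm n Ms
                 \<and> computes n Ms (\<lambda>i j. idm i j + eps n * walsh n i j)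
                 \<and> well_conditioned n (1 + C * eps n) Ms
                 \<longrightarrow> real (length Ms - 1) \<ge> c * (real n * log 2 (real n)) / log 2 (1 / eps n))"
  \<comment> \<open>Lower and upper bound on the final potential give \<open>\<epsilon> * n * ln n /
    2 \<le> m * K * \<epsilon> * ln (1 / \<epsilon>)\<close>; the factor \<open>\<epsilon>\<close>
    cancels and leaves \<open>1 / (2 * K)\<close>.\<close>
  proof (intro exI[of _ "1 / (2 * K)"] exI[of _ "max n1 2"] conjI allI impI)
    show "0 < 1 / (2 * K)" using K by simp
    fix n k :: nat and Ms :: "rmat list"
    assume n0: "max n1 2 \<le> n" and n: "n = 2 ^ k"
      and "is_algorithm n Ms \<and> computes n Ms (\<lambda>i j. idm i j + eps n * walsh n i j)
         \<and> well_conditioned n (1 + C * eps n) Ms"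
    then have alg: "is_algorithm n Ms" and comp: "computes n Ms (\<lambda>i j. idm i j + eps n * walsh n i j)"
      and wc: "well_conditioned n (1 + C * eps n) Ms" by auto
    let ?X = "\<lambda>i j. idm i j + eps n * walsh n i j"
    have eps: "0 < eps n" "eps n < 1/2" using assms(1) by auto
    define L where "L = ln (1 / eps n)"
    have L: "0 < L" using ln_inverse_ge_half[OF eps] by (simp add: L_def)
    have lnn: "0 \<le> ln (real n)" using n0 by simp
    have big: "112 * ln (1 / eps n) \<le> ln n" using n1[of n] n0 lnn by auto
    define m where "m = length Ms - 1"
    have ne: "Ms \<noteq> []" using alg by (simp add: is_algorithm_def)
    then have m: "m < length Ms" "last Ms = Ms ! m" by (simp_all add: m_def last_conv_nth)
    from algorithm_pot_bound[OF biorth_walsh[OF n] eps C alg wc m(1)]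
    obtain N where N: "biorth n (Ms ! m) N" "\<bar>pot n (walsh n) (Ms ! m) N\<bar> \<le> real m * step_cost C (eps n)"
      by blast
    have meq: "meq n (Ms ! m) ?X" using comp m by (simp add: computes_def)
    have "biorth n ?X N" using N(1) meq by (simp add: biorth_def meq_def)
    then have "real n * (eps n * ln n) / 2 \<le> pot n (walsh n) ?X N"
      using n0 by (intro pot_perturbation[OF n _ eps big]) auto
    also have "\<dots> \<le> real m * step_cost C (eps n)" using N(2) pot_meq[OF meq, of "walsh n" N] by simp
    also have "\<dots> = eps n * (real m * (K * L))" by (simp add: step_cost_def K_def L_def)
    finally have "eps n * (real n * ln n / 2) \<le> eps n * (real m * (K * L))" by (simp add: mult_ac)
    then have "real n * ln n / 2 \<le> real m * (K * L)" using eps by simp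
    then have "1 / (2 * K) * (real n * ln n) / L \<le> real m" using K L by (simp add: field_simps)
    \<comment> \<open>The base of the logarithm cancels in the quotient.\<close>
    moreover have "1 / (2 * K) * (real n * log 2 (real n)) / log 2 (1 / eps n)
        = 1 / (2 * K) * (real n * ln n) / L"
      by (simp add: log_def L_def)
    ultimately show "1 / (2 * K) * (real n * log 2 (real n)) / log 2 (1 / eps n) \<le> real (length Ms - 1)"
      by (simp add: m_def)
  qed
qed

end
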